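(* Let $n\ge1$ be an integer, let $\alpha_1,\dots,\alpha_n\ge1$ and $\beta_1,\dots,\beta_n\ge\frac12(1+\sqrt5)$ be real numbers, let $\beta=\min\{\beta_1,\dots,\beta_n\}$, and let $\lambda_1,\dots,\lambda_n$ be positive real numbers. Suppose that $\beta^2-\beta-1\neq0$ and that $$0\le 1-\frac{2\beta+1}{\beta^2-\beta-1}\sum_{j=1}^n\frac1{\lambda_j}<1 .$$ Then the function $$\mathbb{F}_{\alpha_j,\beta_j,\lambda_j}(z)=\int_0^z\prod_{j=1}^n\left(\frac{\mathbb{E}_{\alpha_j,\beta_j}(t)}{t}\right)^{1/\lambda_j}dt,\qquad z\in\mathbb{U},$$ belongs to $\mathcal{C}(\delta)$, where $$\delta=1-\frac{2\beta+1}{\beta^2-\beta-1}\sum_{j=1}^n\frac1{\lambda_j}.$$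
   Context: $\mathbb{U}=\{z\in\mathbb{C}:|z|<1\}$. $\mathcal{A}$ is the class of functions $f(z)=z+\sum_{k\ge2}a_kz^k$ analytic in $\mathbb{U}$. For $0\le\delta<1$, $\mathcal{C}(\delta)$ is the class of $f\in\mathcal{A}$ that are convex of order $\delta$, i.e. $\mathrm{Re}\left(1+\frac{zf''(z)}{f'(z)}\right)>\delta$ for all $z\in\mathbb{U}$. For real $\alpha>0$, $\beta>0$, the normalized Mittag-Leffler function is $$\mathbb{E}_{\alpha,\beta}(z)=\Gamma(\beta)\,z\sum_{k=0}^\infty\frac{z^k}{\Gamma(\alpha k+\beta)}=z+\sum_{k=2}^\infty\frac{\Gamma(\beta)}{\Gamma(\alpha(k-1)+\beta)}z^k .$$ The quotient $\mathbb{E}_{\alpha,\beta}(t)/t$ takes the value $1$ at $t=0$. All many-valued functions (here, the powers with exponent $1/\lambda_j$) are taken with their principal branch. *)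

theory Defs
  imports "HOL-Complex_Analysis.Complex_Analysis"
begin

text \<open>Functions on the open unit disc are total functions on \<^typ>\<open>complex\<close>
  of which only the values on \<^term>\<open>ball (0::complex) 1\<close> matter.\<close>

definition class_A :: "(complex \<Rightarrow> complex) set" where
  "class_A = {f. f holomorphic_on ball 0 1 \<and>
     (\<exists>a :: nat \<Rightarrow> complex. \<forall>z \<in> ball 0 1. (\<lambda>k. a (k + 2) * z ^ (k + 2)) sums (f z - z))}"

text \<open>That the quotient \<open>f'' / f'\<close> is defined on the whole disc is part of the condition.
  Since \<open>x / 0 = 0\<close> in HOL, this has to be said explicitly.\<close>

definition convex_of_order :: "real \<Rightarrow> (complex \<Rightarrow> complex) set" where
  "convex_of_order \<delta> = {f \<in> class_A. \<forall>z \<in> ball 0 1.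
     deriv f z \<noteq> 0 \<and> Re (1 + z * deriv (deriv f) z / deriv f z) > \<delta>}"

definition mittag_leffler :: "real \<Rightarrow> real \<Rightarrow> complex \<Rightarrow> complex" where
  "mittag_leffler \<alpha> \<beta> z =
     of_real (Gamma \<beta>) * z * (\<Sum>k. z ^ k / of_real (Gamma (\<alpha> * real k + \<beta>)))"

definition mittag_leffler_quot :: "real \<Rightarrow> real \<Rightarrow> complex \<Rightarrow> complex" where
  "mittag_leffler_quot \<alpha> \<beta> t = (if t = 0 then 1 else mittag_leffler \<alpha> \<beta> t / t)"

text \<open>The integral from \<open>0\<close> to \<open>z\<close> is taken along the straight segment.
  On \<^typ>\<open>complex\<close>, \<open>powr\<close> is the principal branch.\<close>

definition mittag_leffler_integral ::
    "nat \<Rightarrow> (nat \<Rightarrow> real) \<Rightarrow> (nat \<Rightarrow> real) \<Rightarrow> (nat \<Rightarrow> real) \<Rightarrow> complex \<Rightarrow> complex" where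
  "mittag_leffler_integral n \<alpha> \<beta> l z = contour_integral (linepath 0 z)
     (\<lambda>t. \<Prod>j = 1..n. mittag_leffler_quot (\<alpha> j) (\<beta> j) t powr of_real (1 / l j))"

end

theory Submission
  imports Defs
begin

text \<open>Comparison of \<open>\<Gamma>(\<alpha>k + \<beta>)\<close> with \<open>\<Gamma>(k + \<beta>)\<close> bounds the coefficients of
  \<open>q(z) = E(z)/z\<close> by those of a geometric series of ratio \<open>1/(\<beta> + 1)\<close>. This gives
  \<open>\<bar>q - 1\<bar> \<le> (\<beta> + 1)/\<beta>\<^sup>2 < 1\<close> and \<open>\<bar>q'\<bar> \<le> (\<beta> + 1)\<^sup>2/\<beta>\<^sup>3 \<le> (2\<beta> + 1)/\<beta>\<^sup>2\<close>, so \<open>q\<close> stays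
  in the right half plane, where the principal logarithm is holomorphic, and
  \<open>\<bar>q'/q\<bar> \<le> (2\<beta> + 1)/(\<beta>\<^sup>2 - \<beta> - 1)\<close>. The last bound decreases in \<open>\<beta>\<close>, and the logarithmic
  derivative of the integrand is the sum of the \<open>q\<^sub>j'/(\<lambda>\<^sub>j q\<^sub>j)\<close>.\<close>

section \<open>Geometric majorant of the Taylor coefficients\<close>

definition mittag_leffler_coeff :: "real \<Rightarrow> real \<Rightarrow> nat \<Rightarrow> real" where
  "mittag_leffler_coeff \<alpha> \<beta> k = Gamma \<beta> / Gamma (\<alpha> * real k + \<beta>)"

lemma mittag_leffler_coeff_0:
  assumes "\<beta> > 0"
  shows "mittag_leffler_coeff \<alpha> \<beta> 0 = 1"
  using Gamma_real_pos[OF assms] by (simp add: mittag_leffler_coeff_def)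

text \<open>\<open>Gamma (\<beta> + real (Suc k))\<close> is \<open>Gamma \<beta>\<close> times the
  rising factorial \<beta>(\<beta> + 1)...(\<beta> + k), and each of its factors after the first is
  at least \<beta> + 1. Monotonicity of Gamma then passes from the parameter 1 to \<alpha>.\<close>

lemma mittag_leffler_coeff_Suc_bounds:
  assumes "\<alpha> \<ge> 1" "\<beta> \<ge> 1"
  shows "0 \<le> mittag_leffler_coeff \<alpha> \<beta> (Suc k)"
    and "mittag_leffler_coeff \<alpha> \<beta> (Suc k) \<le> (1 / (\<beta> + 1)) ^ k / \<beta>"
proof -
  have pos: "\<alpha> * real (Suc k) + \<beta> > 0"
    using assms by (intro add_nonneg_pos mult_nonneg_nonneg) auto
  show "0 \<le> mittag_leffler_coeff \<alpha> \<beta> (Suc k)"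
    unfolding mittag_leffler_coeff_def using Gamma_real_pos[of \<beta>] Gamma_real_pos[OF pos] assms
    by (intro divide_nonneg_pos) auto
  have poch: "\<beta> * (\<beta> + 1) ^ k \<le> pochhammer \<beta> (Suc k)"
  proof (induction k)
    case (Suc k)
    have "\<beta> * (\<beta> + 1) ^ Suc k = \<beta> * (\<beta> + 1) ^ k * (\<beta> + 1)" by simp
    also have "\<dots> \<le> pochhammer \<beta> (Suc k) * (\<beta> + real (Suc k))"
      using Suc assms by (intro mult_mono pochhammer_nonneg) auto
    also have "\<dots> = pochhammer \<beta> (Suc (Suc k))" by (simp add: pochhammer_rec')
    finally show ?case .
  qed simp
  have "\<beta> \<notin> \<int>\<^sub>\<le>\<^sub>0" using assms by (auto elim!: nonpos_Ints_cases)
  then have "pochhammer \<beta> (Suc k) * Gamma \<beta> = Gamma (\<beta> + real (Suc k))"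
    using pochhammer_Gamma[of \<beta> "Suc k"] less_imp_neq[OF Gamma_real_pos[of \<beta>]] assms by simp
  also have "\<dots> \<le> Gamma (\<alpha> * real (Suc k) + \<beta>)"
  proof -
    have "1 * real (Suc k) \<le> \<alpha> * real (Suc k)"
      using assms by (intro mult_right_mono) auto
    then have "\<beta> + real (Suc k) \<le> \<alpha> * real (Suc k) + \<beta>" by simp
    \<comment> \<open>Gamma is not monotone on the whole positive axis, but \<beta> + k + 1 is at
      least 2, where it increases. Equal arguments are split off because the monotonicity is
      strict.\<close>
    then show ?thesis
      using Gamma_real_strict_mono[of "\<beta> + real (Suc k)" "\<alpha> * real (Suc k) + \<beta>"] assms(2)
      by (cases "\<beta> + real (Suc k) = \<alpha> * real (Suc k) + \<beta>") (simp only:, simp)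
  qed
  finally have le: "pochhammer \<beta> (Suc k) * Gamma \<beta> \<le> Gamma (\<alpha> * real (Suc k) + \<beta>)" .
  have "\<beta> * (\<beta> + 1) ^ k * Gamma \<beta> \<le> Gamma (\<alpha> * real (Suc k) + \<beta>)"
    using poch Gamma_real_pos[of \<beta>] assms by (intro order.trans[OF mult_right_mono le]) auto
  then have "Gamma \<beta> / Gamma (\<alpha> * real (Suc k) + \<beta>) \<le> 1 / (\<beta> * (\<beta> + 1) ^ k)"
    using Gamma_real_pos[OF pos] assms by (subst frac_le_eq) (auto simp: divide_simps mult_ac)
  then show "mittag_leffler_coeff \<alpha> \<beta> (Suc k) \<le> (1 / (\<beta> + 1)) ^ k / \<beta>"
    by (simp add: mittag_leffler_coeff_def power_divide mult.commute)
qed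

lemma mittag_leffler_series_term_bound:
  assumes "\<alpha> \<ge> 1" "\<beta> \<ge> 1" "norm z \<le> 1"
  shows "norm (complex_of_real (mittag_leffler_coeff \<alpha> \<beta> (Suc k)) * z ^ Suc k)
    \<le> (1 / (\<beta> + 1)) ^ k / \<beta>"
proof -
  have "norm z ^ Suc k \<le> 1"
    using assms by (intro power_le_one) auto
  then have "mittag_leffler_coeff \<alpha> \<beta> (Suc k) * norm z ^ Suc k
      \<le> (1 / (\<beta> + 1)) ^ k / \<beta> * 1"
    using mittag_leffler_coeff_Suc_bounds[OF assms(1,2), of k] assms
    by (intro mult_mono) auto
  then show ?thesis
    using mittag_leffler_coeff_Suc_bounds(1)[OF assms(1,2), of k]
    by (simp add: norm_mult norm_power)
qed

text \<open>The closed disc is covered because differentiating termwise inside the disc relies on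
  convergence at the point 1.\<close>

lemma mittag_leffler_coeff_summable:
  assumes "\<alpha> \<ge> 1" "\<beta> \<ge> 1" "norm z \<le> 1"
  shows "summable (\<lambda>k. complex_of_real (mittag_leffler_coeff \<alpha> \<beta> k) * z ^ k)"
proof -
  have "summable (\<lambda>k. (1 / (\<beta> + 1)) ^ k / \<beta>)"
    using assms by (intro summable_divide summable_geometric) auto
  then have "summable (\<lambda>k. complex_of_real (mittag_leffler_coeff \<alpha> \<beta> (Suc k)) * z ^ Suc k)"
    by (rule summable_comparison_test') (rule mittag_leffler_series_term_bound[OF assms])
  then show ?thesis
    by (subst summable_Suc_iff[symmetric])
qed

section \<open>The quotient q on the disc: series, derivative, logarithmic derivative\<close>

lemma mittag_leffler_quot_power_series:
  assumes "\<alpha> \<ge> 1" "\<beta> \<ge> 1" "norm z \<le> 1"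
  shows "mittag_leffler_quot \<alpha> \<beta> z = (\<Sum>k. of_real (mittag_leffler_coeff \<alpha> \<beta> k) * z ^ k)"
proof (cases "z = 0")
  case True
  then show ?thesis
    using mittag_leffler_coeff_0[of \<beta> \<alpha>] assms by (simp add: mittag_leffler_quot_def)
next
  case False
  have nz: "complex_of_real (Gamma \<beta>) \<noteq> 0"
    using less_imp_neq[OF Gamma_real_pos[of \<beta>]] assms by simp
  have eq: "complex_of_real (mittag_leffler_coeff \<alpha> \<beta> k) * z ^ k
      = of_real (Gamma \<beta>) * (z ^ k / of_real (Gamma (\<alpha> * real k + \<beta>)))" for k
    by (simp add: mittag_leffler_coeff_def)
  \<comment> \<open>Cancelling the nonzero common factor \<open>Gamma \<beta>\<close> gives
    convergence of the unnormalized series, so the factor may be pulled out of the sum.\<close>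
  have "summable (\<lambda>k. z ^ k / complex_of_real (Gamma (\<alpha> * real k + \<beta>)))"
    using mittag_leffler_coeff_summable[OF assms] unfolding eq
    by (subst (asm) summable_cmult_iff) (use nz in auto)
  then show ?thesis
    using False unfolding eq
    by (subst suminf_mult) (auto simp: mittag_leffler_quot_def mittag_leffler_def)
qed

lemma mittag_leffler_quot_minus_1_bound:
  assumes "\<alpha> \<ge> 1" "\<beta> \<ge> 1" "norm z \<le> 1"
  shows "norm (mittag_leffler_quot \<alpha> \<beta> z - 1) \<le> (\<beta> + 1) / \<beta>\<^sup>2"
proof -
  let ?c = "\<lambda>k. complex_of_real (mittag_leffler_coeff \<alpha> \<beta> k) * z ^ k"
  have "mittag_leffler_quot \<alpha> \<beta> z - 1 = (\<Sum>k. ?c (Suc k))"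
    using suminf_split_head[OF mittag_leffler_coeff_summable[OF assms]]
      mittag_leffler_coeff_0[of \<beta> \<alpha>] mittag_leffler_quot_power_series[OF assms] assms
    by simp
  also have "norm \<dots> \<le> (\<Sum>k. (1 / (\<beta> + 1)) ^ k / \<beta>)"
    using assms by (intro norm_suminf_le mittag_leffler_series_term_bound
      summable_divide summable_geometric) auto
  also have "\<dots> = (\<beta> + 1) / \<beta>\<^sup>2"
  proof -
    have "(\<lambda>k. (1 / (\<beta> + 1)) ^ k / \<beta>) sums (1 / (1 - 1 / (\<beta> + 1)) / \<beta>)"
      using assms by (intro sums_divide geometric_sums) auto
    moreover have "1 / (1 - 1 / (\<beta> + 1)) / \<beta> = (\<beta> + 1) / \<beta>\<^sup>2"
      using assms by (simp add: field_simps power2_eq_square)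
    ultimately show ?thesis by (simp add: sums_iff)
  qed
  finally show ?thesis .
qed

lemma mittag_leffler_quot_has_derivative:
  assumes "\<alpha> \<ge> 1" "\<beta> \<ge> 1" "norm z < 1"
  obtains D where "(mittag_leffler_quot \<alpha> \<beta> has_field_derivative D) (at z)"
    and "norm D \<le> (\<beta> + 1)\<^sup>2 / \<beta> ^ 3"
proof
  let ?c = "\<lambda>k. complex_of_real (mittag_leffler_coeff \<alpha> \<beta> k)"
  let ?D = "\<Sum>k. diffs ?c k * z ^ k"
  have "((\<lambda>z. \<Sum>k. ?c k * z ^ k) has_field_derivative ?D) (at z)"
    using mittag_leffler_coeff_summable[OF assms(1,2), of 1] assms(3)
    by (intro termdiffs_strong[of _ 1]) auto
  \<comment> \<open>The quotient is known to equal its series only on the disc, hence the transfer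
    on an open ball.\<close>
  then show "(mittag_leffler_quot \<alpha> \<beta> has_field_derivative ?D) (at z)"
    by (rule has_field_derivative_transform_within_open[of _ _ _ "ball 0 1"])
       (use assms in \<open>auto simp: mittag_leffler_quot_power_series\<close>)
  have r: "norm (1 / (\<beta> + 1)) < 1"
    using assms by simp
  have sums: "(\<lambda>k. of_nat (Suc k) * (1 / (\<beta> + 1)) ^ k / \<beta>) sums (1 / (1 - 1 / (\<beta> + 1))\<^sup>2 / \<beta>)"
    by (intro sums_divide geometric_deriv_sums r)
  have "norm ?D \<le> (\<Sum>k. of_nat (Suc k) * (1 / (\<beta> + 1)) ^ k / \<beta>)"
  proof (rule norm_suminf_le)
    fix k
    have "norm z ^ k \<le> 1"
      using assms by (intro power_le_one) auto
    \<comment> \<open>The coefficient \<open>diffs ?c k\<close> is (k + 1) times coefficient k + 1,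
      so the constant term drops out and the majorant is the differentiated geometric
      series.\<close>
    then have "real (Suc k) * mittag_leffler_coeff \<alpha> \<beta> (Suc k) * norm z ^ k
        \<le> real (Suc k) * ((1 / (\<beta> + 1)) ^ k / \<beta>) * 1"
      using mittag_leffler_coeff_Suc_bounds[OF assms(1,2), of k] assms
      by (intro mult_mono) auto
    then show "norm (diffs ?c k * z ^ k) \<le> of_nat (Suc k) * (1 / (\<beta> + 1)) ^ k / \<beta>"
      using mittag_leffler_coeff_Suc_bounds(1)[OF assms(1,2), of k]
      by (simp add: norm_mult norm_power diffs_def del: of_nat_Suc)
  qed (use sums in \<open>simp add: sums_iff\<close>)
  also have "\<dots> = 1 / (1 - 1 / (\<beta> + 1))\<^sup>2 / \<beta>"
    using sums by (simp add: sums_iff)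
  also have "1 - 1 / (\<beta> + 1) = \<beta> / (\<beta> + 1)"
    using assms by (simp add: field_simps)
  also have "1 / (\<beta> / (\<beta> + 1))\<^sup>2 / \<beta> = (\<beta> + 1)\<^sup>2 / \<beta> ^ 3"
    by (simp add: power_divide power2_eq_square power3_eq_cube)
  finally show "norm ?D \<le> (\<beta> + 1)\<^sup>2 / \<beta> ^ 3" .
qed

text \<open>Positivity of the quadratic says exactly that (\<beta> + 1)/\<beta>^2 < 1, which keeps q
  in the open disc of radius 1 about 1.\<close>

lemma mittag_leffler_quot_Re_pos:
  assumes "\<alpha> \<ge> 1" "\<beta> \<ge> 1" "\<beta>\<^sup>2 - \<beta> - 1 > 0" "norm z \<le> 1"
  shows "Re (mittag_leffler_quot \<alpha> \<beta> z) > 0"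
proof -
  have "(\<beta> + 1) / \<beta>\<^sup>2 < 1"
    using assms by (simp add: divide_simps)
  then have "norm (mittag_leffler_quot \<alpha> \<beta> z - 1) < 1"
    using mittag_leffler_quot_minus_1_bound[OF assms(1,2,4)] by linarith
  then show ?thesis
    using abs_Re_le_cmod[of "mittag_leffler_quot \<alpha> \<beta> z - 1"] by simp
qed

lemma mittag_leffler_quot_holomorphic:
  assumes "\<alpha> \<ge> 1" "\<beta> \<ge> 1"
  shows "mittag_leffler_quot \<alpha> \<beta> holomorphic_on ball 0 1"
  unfolding holomorphic_on_open[OF open_ball]
  using mittag_leffler_quot_has_derivative[OF assms] by (metis mem_ball_0)

lemma mittag_leffler_quot_logderiv_bound:
  assumes "\<alpha> \<ge> 1" "\<beta> \<ge> 1" "\<beta>\<^sup>2 - \<beta> - 1 > 0" "norm z < 1"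
  shows "norm (deriv (mittag_leffler_quot \<alpha> \<beta>) z / mittag_leffler_quot \<alpha> \<beta> z)
    \<le> (2 * \<beta> + 1) / (\<beta>\<^sup>2 - \<beta> - 1)"
proof -
  let ?q = "mittag_leffler_quot \<alpha> \<beta>"
  have "norm (deriv ?q z) \<le> (\<beta> + 1)\<^sup>2 / \<beta> ^ 3"
    using mittag_leffler_quot_has_derivative[OF assms(1,2,4)] DERIV_imp_deriv by metis
  also have "\<dots> \<le> (2 * \<beta> + 1) / \<beta>\<^sup>2"
  proof -
    \<comment> \<open>The difference of the two sides is \<beta>^2 - \<beta> - 1. The weaker bound
      has the denominator \<beta>^2, which cancels against that of the lower bound for |q|.\<close>
    have "(\<beta> + 1)\<^sup>2 \<le> (2 * \<beta> + 1) * \<beta>"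
      using assms(3) by (simp add: power2_eq_square algebra_simps)
    then have "(\<beta> + 1)\<^sup>2 / \<beta> ^ 3 \<le> (2 * \<beta> + 1) * \<beta> / \<beta> ^ 3"
      using assms by (intro divide_right_mono) auto
    then show ?thesis
      using assms by (simp add: power2_eq_square power3_eq_cube)
  qed
  finally have num: "norm (deriv ?q z) \<le> (2 * \<beta> + 1) / \<beta>\<^sup>2" .
  have "1 - norm (?q z) \<le> norm (?q z - 1)"
    by (metis norm_minus_commute norm_one norm_triangle_ineq2)
  also have "\<dots> \<le> (\<beta> + 1) / \<beta>\<^sup>2"
    using mittag_leffler_quot_minus_1_bound[OF assms(1,2)] assms(4) by simp
  finally have "norm (?q z) \<ge> 1 - (\<beta> + 1) / \<beta>\<^sup>2" by simp
  also have "1 - (\<beta> + 1) / \<beta>\<^sup>2 = (\<beta>\<^sup>2 - \<beta> - 1) / \<beta>\<^sup>2"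
    using assms by (simp add: field_simps)
  finally have den: "(\<beta>\<^sup>2 - \<beta> - 1) / \<beta>\<^sup>2 \<le> norm (?q z)" .
  have "norm (deriv ?q z) / norm (?q z) \<le> ((2 * \<beta> + 1) / \<beta>\<^sup>2) / ((\<beta>\<^sup>2 - \<beta> - 1) / \<beta>\<^sup>2)"
    using num den assms by (intro frac_le) auto
  then show ?thesis
    using assms by (simp add: norm_divide)
qed

section \<open>Inequalities for the golden ratio quadratic\<close>

lemma golden_quotient_antimono:
  fixes b \<beta> :: real
  assumes "0 \<le> b" "b \<le> \<beta>" "b\<^sup>2 - b - 1 > 0" "\<beta>\<^sup>2 - \<beta> - 1 > 0"
  shows "(2 * \<beta> + 1) / (\<beta>\<^sup>2 - \<beta> - 1) \<le> (2 * b + 1) / (b\<^sup>2 - b - 1)"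
proof -
  \<comment> \<open>This product is the difference of the two sides after
    cross-multiplication.\<close>
  have "(\<beta> - b) * (2 * b * \<beta> + \<beta> + b + 1) \<ge> 0"
    using assms by (intro mult_nonneg_nonneg) auto
  then have "(2 * \<beta> + 1) * (b\<^sup>2 - b - 1) \<le> (2 * b + 1) * (\<beta>\<^sup>2 - \<beta> - 1)"
    by (simp add: power2_eq_square algebra_simps)
  then show ?thesis
    using assms by (simp add: divide_simps)
qed

text \<open>The bound on \<beta> is the larger root of the quadratic, so the only alternative to
  positivity is a zero.\<close>

lemma golden_polynomial_pos:
  fixes \<beta> :: real
  assumes "\<beta> \<ge> (1 + sqrt 5) / 2" "\<beta>\<^sup>2 - \<beta> - 1 \<noteq> 0"
  shows "\<beta>\<^sup>2 - \<beta> - 1 > 0"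
proof -
  have "\<beta>\<^sup>2 - \<beta> - 1 = (\<beta> - (1 + sqrt 5) / 2) * (\<beta> - (1 - sqrt 5) / 2)"
    by (simp add: field_simps power2_eq_square)
  also have "\<dots> \<ge> 0"
  proof (rule mult_nonneg_nonneg)
    have "(1 - sqrt 5) / 2 \<le> (1 + sqrt 5) / 2" by (intro divide_right_mono) auto
    from order.trans[OF this assms(1)] show "\<beta> - (1 - sqrt 5) / 2 \<ge> 0" by simp
  qed (use assms(1) in simp)
  finally show ?thesis using assms(2) by simp
qed

section \<open>Primitives, normalization, and products of powers\<close>

lemma contour_integral_linepath_has_derivative:
  assumes "f holomorphic_on S" "convex S" "open S" "a \<in> S" "z \<in> S"
  shows "((\<lambda>x. contour_integral (linepath a x) f) has_field_derivative f z) (at z)"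
proof -
  have "((\<lambda>x. contour_integral (linepath a x) f) has_field_derivative f z) (at z within S)"
  \<comment> \<open>In a convex domain every triangle is filled, so Cauchy's theorem makes its
    boundary integral vanish and the segment integrals form a primitive.\<close>
  proof (rule triangle_contour_integrals_convex_primitive)
    fix b c assume "b \<in> S" "c \<in> S"
    then have "convex hull {a, b, c} \<subseteq> S"
      using assms by (intro hull_minimal) auto
    then show "contour_integral (linepath a b) f + contour_integral (linepath b c) f +
        contour_integral (linepath c a) f = 0"
      by (meson Cauchy_theorem_triangle assms(1) has_chain_integral_chain_integral3
          holomorphic_on_subset)
  qed (use assms holomorphic_on_imp_continuous_on in auto)
  then show ?thesis
    using assms at_within_open by metis
qed

lemma class_A_I:
  assumes "f holomorphic_on ball 0 1" "f 0 = 0" "deriv f 0 = 1"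
  shows "f \<in> class_A"
proof -
  have "(\<lambda>k. (deriv ^^ (k + 2)) f 0 / fact (k + 2) * z ^ (k + 2)) sums (f z - z)"
    if "z \<in> ball 0 1" for z
    using sums_split_initial_segment[OF holomorphic_power_series[OF assms(1) that], of 2] assms(2,3)
    by (simp add: numeral_2_eq_2)
  then show ?thesis
    unfolding class_A_def using assms(1)
    \<comment> \<open>\<open>class_A\<close> reads its sequence from index 2 on, so the unshifted
      Taylor coefficients are the witness.\<close>
    by (auto intro!: exI[of _ "\<lambda>k. (deriv ^^ k) f 0 / fact k"])
qed

text \<open>The derivative is written as the product times its logarithmic derivative, so that
  dividing by the product later leaves only the sum. Avoiding the branch cut makes each principal
  power differentiable.\<close>

lemma has_field_derivative_prod_powr:
  assumes "finite J"
    and "\<And>j. j \<in> J \<Longrightarrow> (q j has_field_derivative D j) (at z)"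
    and "\<And>j. j \<in> J \<Longrightarrow> q j z \<notin> \<real>\<^sub>\<le>\<^sub>0"
  shows "((\<lambda>t. \<Prod>j\<in>J. q j t powr p j) has_field_derivative
    (\<Prod>j\<in>J. q j z powr p j) * (\<Sum>j\<in>J. p j * (D j / q j z))) (at (z::complex))"
  using assms
proof (induction J rule: finite_induct)
  case (insert i J)
  have "q i z \<noteq> 0" using insert.prems(2)[of i] by auto
  then have "((\<lambda>t. q i t powr p i) has_field_derivative
      q i z powr p i * (p i * (D i / q i z))) (at z)"
    using insert.prems
    by (auto intro!: derivative_eq_intros simp: powr_diff)
  from DERIV_mult[OF this insert.IH] insert show ?case
    by (simp add: algebra_simps)
qed simp

section \<open>Order of convexity of the integral\<close>

theorem theorem2p5:
  fixes n :: nat and \<alpha> \<beta> l :: "nat \<Rightarrow> real" and b \<delta> :: real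
  assumes "n \<ge> 1"
    and "\<And>j. j \<in> {1..n} \<Longrightarrow> \<alpha> j \<ge> 1"
    and "\<And>j. j \<in> {1..n} \<Longrightarrow> \<beta> j \<ge> (1 + sqrt 5) / 2"
    and "\<And>j. j \<in> {1..n} \<Longrightarrow> l j > 0"
    and "b = Min (\<beta> ` {1..n})"
    and "b\<^sup>2 - b - 1 \<noteq> 0"
    and "\<delta> = 1 - (2 * b + 1) / (b\<^sup>2 - b - 1) * (\<Sum>j = 1..n. 1 / l j)"
    and "0 \<le> \<delta>" and "\<delta> < 1"
  shows "mittag_leffler_integral n \<alpha> \<beta> l \<in> convex_of_order \<delta>"
proof -
  define q where "q j = mittag_leffler_quot (\<alpha> j) (\<beta> j)" for j
  define g where "g t = (\<Prod>j = 1..n. q j t powr complex_of_real (1 / l j))" for t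
  \<comment> \<open>\<open>h\<close> is the logarithmic derivative of \<open>g\<close>, which
    becomes F''/F' since F' = \<open>g\<close>.\<close>
  define h where "h z = (\<Sum>j = 1..n. complex_of_real (1 / l j) * (deriv (q j) z / q j z))" for z
  let ?F = "mittag_leffler_integral n \<alpha> \<beta> l"
  define M where "M = (2 * b + 1) / (b\<^sup>2 - b - 1)"
  have ne: "\<beta> ` {1..n} \<noteq> {}" using assms(1) by auto
  have golden_ge_1: "(1 + sqrt 5) / 2 \<ge> (1::real)"
    by simp
  have "b \<in> \<beta> ` {1..n}"
    unfolding assms(5) using ne by (intro Min_in) auto
  then have b_ge: "b \<ge> (1 + sqrt 5) / 2" using assms(3) by auto
  have b_pos: "b\<^sup>2 - b - 1 > 0" by (rule golden_polynomial_pos[OF b_ge assms(6)])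
  have b_le: "b \<le> \<beta> j" if "j \<in> {1..n}" for j
    unfolding assms(5) using that by (intro Min_le) auto
  have \<beta>_ge_1: "\<beta> j \<ge> 1" if "j \<in> {1..n}" for j
    using assms(3)[OF that] golden_ge_1 by linarith
  have \<beta>_pos: "(\<beta> j)\<^sup>2 - \<beta> j - 1 > 0" if "j \<in> {1..n}" for j
  proof -
    \<comment> \<open>x(x - 1) increases for x at least 1, so positivity of the quadratic passes
      from the minimum \<open>b\<close> to every \<beta>_j.\<close>
    have "b * (b - 1) \<le> \<beta> j * (\<beta> j - 1)"
      using b_le[OF that] b_ge golden_ge_1 by (intro mult_mono) linarith+
    then show ?thesis using b_pos by (simp add: power2_eq_square algebra_simps)
  qed
  have q_nonpos: "q j z \<notin> \<real>\<^sub>\<le>\<^sub>0" if "j \<in> {1..n}" "norm z < 1" for j z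
    using mittag_leffler_quot_Re_pos[OF assms(2)[OF that(1)] \<beta>_ge_1[OF that(1)] \<beta>_pos[OF that(1)], of z]
      that(2)
    unfolding q_def by (auto simp: complex_nonpos_Reals_iff)
  have q_deriv: "(q j has_field_derivative deriv (q j) z) (at z)"
    if "j \<in> {1..n}" "norm z < 1" for j z
    using mittag_leffler_quot_holomorphic[OF assms(2)[OF that(1)] \<beta>_ge_1[OF that(1)]] that(2)
    unfolding q_def by (intro holomorphic_derivI) auto
  have q_bound: "norm (deriv (q j) z / q j z) \<le> M" if "j \<in> {1..n}" "norm z < 1" for j z
  proof -
    have "norm (deriv (q j) z / q j z) \<le> (2 * \<beta> j + 1) / ((\<beta> j)\<^sup>2 - \<beta> j - 1)"
      unfolding q_def using that assms(2) \<beta>_ge_1 \<beta>_pos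
      by (intro mittag_leffler_quot_logderiv_bound) auto
    also have "\<dots> \<le> M"
      unfolding M_def using b_le[OF that(1)] b_pos \<beta>_pos[OF that(1)] b_ge golden_ge_1
      by (intro golden_quotient_antimono) linarith+
    finally show ?thesis .
  qed
  have g_deriv: "(g has_field_derivative g z * h z) (at z)" if "norm z < 1" for z
    unfolding g_def h_def using that q_deriv q_nonpos
    by (intro has_field_derivative_prod_powr) auto
  have g_hol: "g holomorphic_on ball 0 1"
    unfolding holomorphic_on_open[OF open_ball] using g_deriv by (metis mem_ball_0)
  have g_nz: "g z \<noteq> 0" if "norm z < 1" for z
  proof -
    have "q j z \<noteq> 0" if "j \<in> {1..n}" for j
      using q_nonpos[OF that \<open>norm z < 1\<close>] by auto
    then show ?thesis by (simp add: g_def)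
  qed
  have F_eq: "?F = (\<lambda>z. contour_integral (linepath 0 z) g)"
    by (rule ext) (simp only: mittag_leffler_integral_def g_def[abs_def] q_def)
  have F_deriv: "(?F has_field_derivative g z) (at z)" if "norm z < 1" for z
    unfolding F_eq using that g_hol
    by (intro contour_integral_linepath_has_derivative[of _ "ball 0 1"]) auto
  have F_deriv_eq: "deriv ?F z = g z" if "norm z < 1" for z
    using F_deriv[OF that] by (rule DERIV_imp_deriv)
  have F_deriv2: "deriv (deriv ?F) z = g z * h z" if "norm z < 1" for z
    by (rule DERIV_imp_deriv, rule has_field_derivative_transform_within_open[OF g_deriv[OF that], of "ball 0 1"])
       (use that in \<open>auto simp: F_deriv_eq\<close>)
  have "?F \<in> class_A"
  proof (rule class_A_I)
    show "?F holomorphic_on ball 0 1"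
      unfolding holomorphic_on_open[OF open_ball] using F_deriv by (metis mem_ball_0)
    show "?F 0 = 0" by (simp add: F_eq)
    show "deriv ?F 0 = 1"
      by (simp add: F_deriv_eq g_def q_def mittag_leffler_quot_def)
  qed
  moreover have "Re (1 + z * deriv (deriv ?F) z / deriv ?F z) > \<delta>" if z: "norm z < 1" for z
  proof -
    have "norm (h z) \<le> (\<Sum>j = 1..n. 1 / l j * M)"
      unfolding h_def
    proof (rule sum_norm_le)
      fix j assume j: "j \<in> {1..n}"
      then have "norm (complex_of_real (1 / l j)) = 1 / l j"
        using assms(4)[OF j] by (simp add: norm_divide)
      then show "norm (complex_of_real (1 / l j) * (deriv (q j) z / q j z)) \<le> 1 / l j * M"
        unfolding norm_mult using q_bound[OF j z] assms(4)[OF j]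
        by (simp only:) (intro mult_left_mono, auto)
    qed
    also have "\<dots> = 1 - \<delta>"
      unfolding assms(7) M_def by (simp only: sum_distrib_right[symmetric]) (simp add: mult.commute)
    finally have "norm (z * h z) \<le> norm z * (1 - \<delta>)"
      by (simp add: norm_mult mult_left_mono)
    \<comment> \<open>Strictness comes from |z| < 1 together with 1 - \<delta> > 0; this also covers
      z = 0.\<close>
    also have "\<dots> < 1 - \<delta>" using z assms(9) by simp
    finally have "norm (z * h z) < 1 - \<delta>" .
    moreover have "z * deriv (deriv ?F) z / deriv ?F z = z * h z"
      using g_nz[OF z] by (simp add: F_deriv_eq F_deriv2 z)
    ultimately show ?thesis
      using abs_Re_le_cmod[of "z * h z"] by simp
  qed
  ultimately show ?thesis
    using F_deriv_eq g_nz by (auto simp: convex_of_order_def)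
qed

end
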